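(* Let $G$ be a graph with $|V(G)|\ge 4$ containing two edge-disjoint spanning triangle-trees. Then $G\in\mathcal{S}_3$.
   Context: Graphs are finite, may contain parallel edges, but have no loops. Triangle-tree: a graph formed by starting with a triangle $x_1x_2x_3$ and then repeatedly (zero or more times) adding a new vertex $x_{j+1}$ joined to exactly two vertices $y,z$ that are adjacent in the graph already constructed (so $x_{j+1},y,z$ form a triangle). A spanning triangle-tree of $G$ is a subgraph of $G$ that is a triangle-tree and contains all vertices of $G$. A $\mathbb{Z}_3$-boundary of $G$ is a map $\beta:V(G)\to\mathbb{Z}_3$ with $\sum_{v\in V(G)}\beta(v)\equiv 0\pmod 3$. $\mathcal{S}_3$ is the family of all graphs $G$ such that for every $\mathbb{Z}_3$-boundary $\beta$ of $G$ there is a strongly connected orientation $D$ of $G$ with $d_D^+(u)-d_D^-(u)\equiv\beta(u)\pmod 3$ for every $u\in V(G)$ (out-degree minus in-degree). *)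

theory Defs
  imports "Graph_Theory.Digraph_Component" "HOL-Number_Theory.Cong"
begin

text \<open>Undirected multigraphs. Edges are named, and \<open>mends G e\<close> is the set of the two ends of \<open>e\<close>;
  distinct edges may have the same ends.\<close>

record ('a, 'e) multigraph =
  mverts :: "'a set"
  medges :: "'e set"
  mends :: "'e \<Rightarrow> 'a set"

locale fin_loopless_multigraph =
  fixes G :: "('a, 'e) multigraph"
  assumes finite_mverts: "finite (mverts G)"
    and finite_medges: "finite (medges G)"
    and mends_subset: "e \<in> medges G \<Longrightarrow> mends G e \<subseteq> mverts G"
    and card_mends: "e \<in> medges G \<Longrightarrow> card (mends G e) = 2"

definition msubgraph :: "('a, 'e) multigraph \<Rightarrow> ('a, 'e) multigraph \<Rightarrow> bool" where
  "msubgraph H G \<longleftrightarrow>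
     fin_loopless_multigraph H \<and> mverts H \<subseteq> mverts G \<and> medges H \<subseteq> medges G \<and>
     (\<forall>e \<in> medges H. mends H e = mends G e)"

inductive triangle_tree_on :: "('e \<Rightarrow> 'a set) \<Rightarrow> 'a set \<Rightarrow> 'e set \<Rightarrow> bool"
  for ends :: "'e \<Rightarrow> 'a set"
where
  triangle:
    "triangle_tree_on ends {x\<^sub>1, x\<^sub>2, x\<^sub>3} {e\<^sub>1, e\<^sub>2, e\<^sub>3}"
    if "distinct [x\<^sub>1, x\<^sub>2, x\<^sub>3]"
      and "ends e\<^sub>1 = {x\<^sub>2, x\<^sub>3}" and "ends e\<^sub>2 = {x\<^sub>1, x\<^sub>3}" and "ends e\<^sub>3 = {x\<^sub>1, x\<^sub>2}"
| add_vertex: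
    "triangle_tree_on ends (insert x V) (insert f (insert g E))"
    if "triangle_tree_on ends V E"
      and "x \<notin> V" and "e \<in> E" and "ends e = {y, z}" and "y \<noteq> z"
      and "ends f = {x, y}" and "ends g = {x, z}"

definition triangle_tree :: "('a, 'e) multigraph \<Rightarrow> bool" where
  "triangle_tree T \<longleftrightarrow> triangle_tree_on (mends T) (mverts T) (medges T)"

text \<open>The edges named in the rules are automatically distinct from each other and from those
  already present, since their ends differ; the edge count below confirms this.\<close>

lemma triangle_tree_on_wf:
  assumes "triangle_tree_on ends V E"
  shows "finite V \<and> finite E \<and> (\<forall>e\<in>E. ends e \<subseteq> V \<and> card (ends e) = 2) \<and>
    3 \<le> card V \<and> card E + 3 = 2 * card V"
  using assms
proof induction
  case (triangle x\<^sub>1 x\<^sub>2 x\<^sub>3 e\<^sub>1 e\<^sub>2 e\<^sub>3)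
  then have "e\<^sub>1 \<noteq> e\<^sub>2" "e\<^sub>1 \<noteq> e\<^sub>3" "e\<^sub>2 \<noteq> e\<^sub>3"
    by (auto simp: doubleton_eq_iff)
  with triangle show ?case by auto
next
  case (add_vertex V E x e y z f g)
  then have yz: "y \<in> V" "z \<in> V" by auto
  have "f \<noteq> g" using add_vertex by (auto simp: doubleton_eq_iff)
  moreover have "f \<notin> E" "g \<notin> E" using add_vertex by auto
  ultimately show ?case using add_vertex yz by (auto simp: card_insert_if)
qed

definition spanning_triangle_tree :: "('a, 'e) multigraph \<Rightarrow> ('a, 'e) multigraph \<Rightarrow> bool" where
  "spanning_triangle_tree T G \<longleftrightarrow>
     msubgraph T G \<and> triangle_tree T \<and> mverts T = mverts G"

definition orientation :: "('a, 'e) pre_digraph \<Rightarrow> ('a, 'e) multigraph \<Rightarrow> bool" where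
  "orientation D G \<longleftrightarrow>
     verts D = mverts G \<and> arcs D = medges G \<and>
     (\<forall>e \<in> medges G. {tail D e, head D e} = mends G e)"

text \<open>Elements of \<open>\<int>/3\<int>\<close> are represented by the residues 0, 1, 2. Values of \<open>\<beta>\<close> outside the
  vertex set are irrelevant.\<close>

definition Z3_boundary :: "('a, 'e) multigraph \<Rightarrow> ('a \<Rightarrow> int) \<Rightarrow> bool" where
  "Z3_boundary G \<beta> \<longleftrightarrow>
     (\<forall>v \<in> mverts G. \<beta> v \<in> {0..<3}) \<and> [(\<Sum>v \<in> mverts G. \<beta> v) = 0] (mod 3)"

definition S3 :: "('a, 'e) multigraph set" where
  "S3 = {G. fin_loopless_multigraph G \<and>
     (\<forall>\<beta>. Z3_boundary G \<beta> \<longrightarrow>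
       (\<exists>D. orientation D G \<and> strongly_connected D \<and>
         (\<forall>u \<in> mverts G. [int (out_degree D u) - int (in_degree D u) = \<beta> u] (mod 3))))}"

end

theory Submission
  imports Defs "HOL-Library.Numeral_Type"
begin

text \<open>
  A triangle-tree \<open>T\<close> on \<open>n\<close> vertices fails to realize a boundary \<open>\<beta>\<close> only if
  \<open>\<beta> = \<Sum>\<epsilon>\<^sub>t 1\<^sub>t\<close> with all \<open>\<epsilon>\<^sub>t = \<plusminus>1\<close>, where \<open>t\<close> runs over the \<open>n - 2\<close> (linearly independent)
  triangles of \<open>T\<close>: a vertex \<open>x\<close> of degree two with \<open>\<beta>(x) \<noteq> 0\<close> forces both its edges, and if
  \<open>\<beta>(x) = 0\<close>, then \<open>x\<close> and the opposite edge \<open>yz\<close> can carry any flow between \<open>y\<close> and \<open>z\<close>, so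
  that \<open>yz\<close> may be contracted, whence everything is realizable. On the other hand, \<open>T\<close> has strongly
  connected orientations realizing all sums \<open>\<Sum>\<plusminus>u\<^sub>i\<close> for some vectors \<open>u\<^sub>1, \<dots>, u\<^sub>n\<^sub>-\<^sub>3\<close> of the form
  \<open>1\<^sub>y - 1\<^sub>z\<close>: a new vertex may be attached to a strongly connected orientation by a directed path
  of length two in either direction.

  Use the second fact for one tree and the first for the other. If all \<open>\<beta> - \<Sum>\<plusminus>u\<^sub>i\<close> were of the
  form \<open>\<Sum>\<epsilon>\<^sub>t 1\<^sub>t\<close>, the \<open>u\<^sub>i\<close> would have disjoint supports in the triangle coordinates, since two
  different signs at a common coordinate would let it vanish, and each support would have at least
  two elements, since \<open>1\<^sub>y - 1\<^sub>z\<close> is not a multiple of any \<open>1\<^sub>t\<close>. Hence \<open>2(n - 3) \<le> n - 2\<close>, so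
  \<open>n = 4\<close>, and moreover \<open>\<beta> = 0\<close>; this single case is settled by an explicit orientation.
\<close>

section \<open>Arithmetic in the three-element ring \<open>3\<close>\<close>

lemma z3_cases:
  fixes x :: 3
  obtains "x = 0" | "x = 1" | "x = -1"
proof (cases x rule: bit1_cases)
  case (of_int z)
  then have "z = 0 \<or> z = 1 \<or> z = 2" by auto
  then show ?thesis using of_int that by auto
qed

text \<open>A directed edge carries 1 or -1, never 0. Two signs already sum to every residue (0 = 1
  - 1, 1 = -1 - 1, -1 = 1 + 1), so a pair of edges acting in parallel can carry any flow.\<close>

lemma z3_sum_of_signs:
  fixes c :: 3
  obtains a b :: 3 where "a \<in> {1, -1}" "b \<in> {1, -1}" "c = a + b"
proof (cases c rule: z3_cases)
  case 1 then show ?thesis using that[of 1 "-1"] by simp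
next
  case 2 then show ?thesis using that[of "-1" "-1"] by simp
next
  case 3 then show ?thesis using that[of 1 1] by simp
qed

lemma z3_of_int_eq_iff: "(of_int a :: 3) = of_int b \<longleftrightarrow> [a = b] (mod 3)"
proof -
  have *: "(of_int c :: 3) = 0 \<longleftrightarrow> 3 dvd c" for c :: int
  proof -
    have "(3::3) = 0" by simp
    have "(of_int c :: 3) = of_int (3 * (c div 3) + c mod 3)" by simp
    also have "\<dots> = of_int (c mod 3)" by (simp only: of_int_add of_int_mult of_int_numeral \<open>(3::3) = 0\<close> mult_zero_left add_0_left)
    finally have e: "(of_int c :: 3) = of_int (c mod 3)" .
    have "c mod 3 = 0 \<or> c mod 3 = 1 \<or> c mod 3 = 2" by presburger
    then show ?thesis using e by (auto simp: dvd_eq_mod_eq_0)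
  qed
  show ?thesis using *[of "a - b"] by (simp add: cong_iff_dvd_diff)
qed

section \<open>Edge vectors and boundaries\<close>

definition edge_vec :: "'a \<Rightarrow> 'a \<Rightarrow> 'a \<Rightarrow> 3" where
  "edge_vec y z v = of_bool (v = y) - of_bool (v = z)"

lemma edge_vec_swap: "edge_vec z y v = - edge_vec y z v"
  by (simp add: edge_vec_def)

text \<open>Vanishing outside \<open>V\<close> makes boundaries for different vertex sets functions
  on the same type, so that equations hold at all \<open>v\<close> and a vertex of value 0 can
  simply be dropped.\<close>

definition boundary_on :: "'a set \<Rightarrow> ('a \<Rightarrow> 3) \<Rightarrow> bool" where
  "boundary_on V \<beta> \<longleftrightarrow> (\<forall>v. v \<notin> V \<longrightarrow> \<beta> v = 0) \<and> sum \<beta> V = 0"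

lemma sum_edge_vec:
  assumes "finite V" "y \<in> V" "z \<in> V"
  shows "sum (edge_vec y z) V = 0"
  using assms by (simp add: edge_vec_def sum_subtractf of_bool_def)

lemma boundary_on_edge_vec:
  assumes "finite V" "y \<in> V" "z \<in> V"
  shows "boundary_on V (edge_vec y z)"
  using assms sum_edge_vec[OF assms] by (auto simp: boundary_on_def edge_vec_def)

lemma boundary_on_add:
  "boundary_on V \<beta> \<Longrightarrow> boundary_on V \<gamma> \<Longrightarrow> boundary_on V (\<lambda>v. \<beta> v + \<gamma> v)"
  by (simp add: boundary_on_def sum.distrib)

lemma boundary_on_diff:
  "boundary_on V \<beta> \<Longrightarrow> boundary_on V \<gamma> \<Longrightarrow> boundary_on V (\<lambda>v. \<beta> v - \<gamma> v)"
  by (simp add: boundary_on_def sum_subtractf)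

lemma boundary_on_mult: "boundary_on V \<beta> \<Longrightarrow> boundary_on V (\<lambda>v. c * \<beta> v)"
  by (simp add: boundary_on_def sum_distrib_left[symmetric])

section \<open>Orientations built edge by edge\<close>

text \<open>An orientation is recorded through its arcs and its outdegree minus indegree. Parallel
  arcs merge in \<open>A\<close>, which is harmless because \<open>A\<close> serves for
  reachability; \<open>\<beta>\<close> still counts every edge.\<close>

inductive oriented_net ::
    "('e \<Rightarrow> 'a set) \<Rightarrow> 'e set \<Rightarrow> ('a \<times> 'a) set \<Rightarrow> ('a \<Rightarrow> 3) \<Rightarrow> bool"
  for ends :: "'e \<Rightarrow> 'a set"
where
  empty: "oriented_net ends {} {} (\<lambda>v. 0)"
| insert: "oriented_net ends (insert e E) (insert (y, z) A) (\<lambda>v. \<beta> v + edge_vec y z v)"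
    if "oriented_net ends E A \<beta>" and "e \<notin> E" and "ends e = {y, z}" and "y \<noteq> z"

definition orientable :: "('e \<Rightarrow> 'a set) \<Rightarrow> 'e set \<Rightarrow> ('a \<Rightarrow> 3) \<Rightarrow> bool" where
  "orientable ends E \<beta> \<longleftrightarrow> (\<exists>A. oriented_net ends E A \<beta>)"

lemma orientable_empty: "orientable ends {} (\<lambda>v. 0)"
  unfolding orientable_def using oriented_net.empty by blast

text \<open>The sign \<open>a\<close> is the direction given to \<open>e\<close>: 1 from
  \<open>y\<close> to \<open>z\<close>, and -1 from \<open>z\<close> to \<open>y\<close>.\<close>

lemma orientable_insert:
  assumes "ends e = {y, z}" "orientable ends E \<gamma>" "e \<notin> E" "y \<noteq> z" "a \<in> {1, -1}"
    and eq: "\<And>v. \<beta> v = \<gamma> v + a * edge_vec y z v"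
  shows "orientable ends (insert e E) \<beta>"
proof -
  from assms(2) obtain A where A: "oriented_net ends E A \<gamma>" unfolding orientable_def by blast
  have \<beta>: "\<beta> = (\<lambda>v. \<gamma> v + a * edge_vec y z v)" using eq by blast
  show ?thesis
  proof (cases "a = 1")
    case True
    then show ?thesis
      using oriented_net.insert[OF A assms(3,1,4)] unfolding \<beta> orientable_def by auto
  next
    case False
    then have "a = -1" using assms by auto
    moreover have "ends e = {z, y}" using assms by auto
    ultimately show ?thesis
      using oriented_net.insert[OF A assms(3), of z y] assms(4)
      unfolding \<beta> orientable_def by (auto simp: edge_vec_swap[of z y])
  qed
qed

lemma oriented_net_union:
  assumes "oriented_net ends E A \<beta>" "oriented_net ends F B \<gamma>" "E \<inter> F = {}"
  shows "oriented_net ends (E \<union> F) (A \<union> B) (\<lambda>v. \<beta> v + \<gamma> v)"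
  using assms
proof (induction rule: oriented_net.induct)
  case empty
  then show ?case by simp
next
  case (insert E A \<beta> e y z)
  then have "oriented_net ends (E \<union> F) (A \<union> B) (\<lambda>v. \<beta> v + \<gamma> v)" by auto
  from oriented_net.insert[where ends = ends, OF this _ insert.hyps(3,4)] insert.hyps insert.prems
  show ?case by (simp add: algebra_simps)
qed

lemma oriented_net_boundary_on:
  assumes "oriented_net ends E A \<beta>" "finite V" "\<forall>e\<in>E. ends e \<subseteq> V"
  shows "boundary_on V \<beta>"
  using assms
proof (induction rule: oriented_net.induct)
  case empty
  then show ?case by (simp add: boundary_on_def)
next
  case (insert E A \<beta> e y z)
  then show ?case by (simp add: boundary_on_add boundary_on_edge_vec)
qed

lemma oriented_net_exists:
  assumes "finite E" "\<forall>e\<in>E. card (ends e) = 2"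
  shows "\<exists>A \<beta>. oriented_net ends E A \<beta>"
  using assms
proof (induction rule: finite_induct)
  case empty
  then show ?case using oriented_net.empty by blast
next
  case (insert e E)
  then obtain y z where yz: "ends e = {y, z}" "y \<noteq> z" by (metis card_2_iff insertI1)
  from insert obtain A \<beta> where "oriented_net ends E A \<beta>" by auto
  from oriented_net.insert[OF this insert.hyps(2) yz] show ?case by blast
qed

text \<open>Recovers the tail and head maps that a digraph needs and reads the accumulated vector as
  a difference of degree counts.\<close>

lemma oriented_net_orientation:
  assumes "oriented_net ends E A \<beta>"
  shows "finite E \<and> (\<exists>t h. (\<forall>e\<in>E. {t e, h e} = ends e) \<and> A = (\<lambda>e. (t e, h e)) ` E \<and>
    (\<forall>v. \<beta> v = of_int (int (card {e \<in> E. t e = v}) - int (card {e \<in> E. h e = v}))))"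
  using assms
proof (induction rule: oriented_net.induct)
  case empty
  then show ?case by simp
next
  case (insert E A \<beta> e y z)
  then obtain t h where fin: "finite E" and th: "\<forall>e\<in>E. {t e, h e} = ends e"
    "A = (\<lambda>e. (t e, h e)) ` E"
    "\<And>v. \<beta> v = of_int (int (card {e \<in> E. t e = v}) - int (card {e \<in> E. h e = v}))"
    by blast
  have count: "card {e' \<in> insert e E. (k(e := w)) e' = v} =
      card {e' \<in> E. k e' = v} + of_bool (v = w)" for k w v
  proof -
    have "{e' \<in> insert e E. (k(e := w)) e' = v} =
        (if v = w then insert e {e' \<in> E. k e' = v} else {e' \<in> E. k e' = v})"
      using insert.hyps(2) by auto
    then show ?thesis using fin insert.hyps(2) by simp
  qed
  have "\<forall>e'\<in>insert e E. {(t(e := y)) e', (h(e := z)) e'} = ends e'"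
    using th insert.hyps by auto
  moreover have "insert (y, z) A = (\<lambda>e'. ((t(e := y)) e', (h(e := z)) e')) ` insert e E"
  proof -
    have "A = (\<lambda>e'. ((t(e := y)) e', (h(e := z)) e')) ` E"
      unfolding th(2) using insert.hyps(2) by (intro image_cong) auto
    then show ?thesis by simp
  qed
  moreover have "\<beta> v + edge_vec y z v =
      of_int (int (card {e' \<in> insert e E. (t(e := y)) e' = v}) -
              int (card {e' \<in> insert e E. (h(e := z)) e' = v}))" for v
    unfolding count th(3) by (simp add: edge_vec_def)
  ultimately show ?case using fin by blast
qed

section \<open>Realizing boundaries after contraction of an edge of a two-tree\<close>

text \<open>Realizability of \<open>\<beta>\<close> modulo \<open>1\<^sub>y - 1\<^sub>z\<close>, that is, after identifying \<open>y\<close> and \<open>z\<close>.\<close>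

definition contracted_net ::
    "('e \<Rightarrow> 'a set) \<Rightarrow> 'e set \<Rightarrow> 'a \<Rightarrow> 'a \<Rightarrow> ('a \<Rightarrow> 3) \<Rightarrow> bool" where
  "contracted_net ends E y z \<beta> \<longleftrightarrow>
    (\<exists>c \<gamma>. orientable ends E \<gamma> \<and> (\<forall>v. \<beta> v = \<gamma> v + c * edge_vec y z v))"

lemma contracted_netI:
  assumes "orientable ends E \<gamma>" "\<And>v. \<beta> v = \<gamma> v + c * edge_vec y z v"
  shows "contracted_net ends E y z \<beta>"
  using assms unfolding contracted_net_def by blast

lemma contracted_net_swap:
  assumes "contracted_net ends E y z \<beta>"
  shows "contracted_net ends E z y \<beta>"
proof -
  from assms obtain c \<gamma> where "orientable ends E \<gamma>" "\<And>v. \<beta> v = \<gamma> v + c * edge_vec y z v"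
    unfolding contracted_net_def by blast
  then have "orientable ends E \<gamma>" "\<forall>v. \<beta> v = \<gamma> v + (- c) * edge_vec z y v"
    by (simp_all add: edge_vec_swap[of y z])
  then show ?thesis unfolding contracted_net_def by blast
qed

lemma contracted_net_ends:
  assumes "contracted_net ends E y z \<beta>" "{y, z} = {y', z'}"
  shows "contracted_net ends E y' z' \<beta>"
  using assms contracted_net_swap by (metis doubleton_eq_iff)

text \<open>Treats contraction of the pair \<open>x\<close>, \<open>y\<close> when \<open>x\<close>
  is a new vertex attached to \<open>e\<close>. Identifying \<open>x\<close> with \<open>y\<close>
  moves \<open>\<beta> x\<close> to \<open>y\<close> and makes \<open>g\<close> parallel to
  \<open>e\<close>; the coefficient \<open>c\<close> left over from contracting \<open>e\<close> is
  then split into signs for \<open>e\<close> and \<open>g\<close>.\<close>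

lemma contracted_net_pendant_edge:
  assumes cn: "contracted_net ends (E - {e}) y z (\<lambda>v. if v = x then 0 else if v = y then \<beta> y + \<beta> x else \<beta> v)"
    and e: "e \<in> E" "ends e = {y, z}" and g: "g \<notin> E" "ends g = {x, z}"
    and ne: "y \<noteq> z" "x \<noteq> y" "x \<noteq> z"
  shows "contracted_net ends (insert g E) x y \<beta>"
proof -
  from cn obtain c \<gamma> where on: "orientable ends (E - {e}) \<gamma>"
    and eq: "\<And>v. (if v = x then 0 else if v = y then \<beta> y + \<beta> x else \<beta> v) = \<gamma> v + c * edge_vec y z v"
    unfolding contracted_net_def by blast
  obtain a b where ab: "a \<in> {1, -1}" "b \<in> {1, -1}" "c = a + b" by (rule z3_sum_of_signs)
  have "orientable ends (insert e (E - {e})) (\<lambda>v. \<gamma> v + a * edge_vec y z v)"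
    by (rule orientable_insert[where ends = ends, OF e(2) on _ ne(1) ab(1)]) auto
  then have "orientable ends E (\<lambda>v. \<gamma> v + a * edge_vec y z v)"
    using e(1) by (simp add: insert_absorb)
  then have "orientable ends (insert g E) (\<lambda>v. \<gamma> v + a * edge_vec y z v + b * edge_vec x z v)"
    by (rule orientable_insert[where ends = ends, OF g(2) _ g(1) ne(3) ab(2)]) auto
  \<comment> \<open>At \<open>x\<close> the edge \<open>g\<close> supplies \<open>b\<close>; the
    missing \<open>\<beta> x - b\<close> is charged to the contracted pair.\<close>
  moreover have "\<beta> v = \<gamma> v + a * edge_vec y z v + b * edge_vec x z v + (\<beta> x - b) * edge_vec x y v" for v
    using eq[of v] eq[of y] ne ab(3) by (auto simp: edge_vec_def algebra_simps split: if_splits)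
  ultimately show ?thesis unfolding contracted_net_def by blast
qed

text \<open>Starting from a single edge instead of a triangle reduces the base case of each induction
  below to a triviality; the triangle becomes an instance of the inductive step.\<close>

inductive two_tree :: "('e \<Rightarrow> 'a set) \<Rightarrow> 'a set \<Rightarrow> 'e set \<Rightarrow> bool"
  for ends :: "'e \<Rightarrow> 'a set"
where
  edge: "two_tree ends {y, z} {e}" if "ends e = {y, z}" and "y \<noteq> z"
| add_vertex: "two_tree ends (insert x V) (insert f (insert g E))"
    if "two_tree ends V E" and "x \<notin> V" and "e \<in> E" and "ends e = {y, z}" and "y \<noteq> z"
      and "ends f = {x, y}" and "ends g = {x, z}"

lemma two_tree_wf:
  assumes "two_tree ends V E"
  shows "finite V \<and> (\<forall>e\<in>E. ends e \<subseteq> V) \<and> 2 \<le> card V"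
  using assms
proof induction
  case (edge e y z)
  then show ?case by auto
next
  case (add_vertex V E x e y z f g)
  then have "y \<in> V" "z \<in> V" by auto
  with add_vertex show ?case by (auto simp: card_insert_if)
qed

lemma triangle_tree_on_imp_two_tree:
  assumes "triangle_tree_on ends V E"
  shows "two_tree ends V E"
  using assms
proof induction
  case (triangle x1 x2 x3 e1 e2 e3)
  then have "two_tree ends {x2, x3} {e1}" by (intro two_tree.edge) auto
  then have "two_tree ends (insert x1 {x2, x3}) (insert e3 (insert e2 {e1}))"
    by (rule two_tree.add_vertex[where e = e1 and y = x2 and z = x3]) (use triangle in auto)
  then show ?case by (simp add: insert_commute)
next
  case (add_vertex V E x e y z f g)
  then show ?case by (intro two_tree.add_vertex)
qed

lemma boundary_on_remove:
  assumes "boundary_on (insert x V) \<beta>" "finite V" "x \<notin> V" "\<beta> x = 0"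
  shows "boundary_on V \<beta>"
  using assms by (auto simp: boundary_on_def)

text \<open>Induction along the construction, with last vertex \<open>x\<close>. If \<open>e\<close>
  is older than \<open>x\<close>, the edges \<open>f\<close> and \<open>g\<close> take two signs
  with sum \<open>\<beta> x\<close>, and the remainder lives on \<open>V\<close>. If
  \<open>e\<close> is \<open>f\<close> or \<open>g\<close>, identifying its ends reduces the claim
  to contracting the edge to which \<open>x\<close> was attached.\<close>

lemma two_tree_contracted_net:
  assumes "two_tree ends V E" "e \<in> E" "ends e = {y, z}" "boundary_on V \<beta>"
  shows "contracted_net ends (E - {e}) y z \<beta>"
  using assms
proof (induction arbitrary: e y z \<beta>)
  case (edge e' y' z')
  have sum0: "\<beta> y' + \<beta> z' = 0" and out: "\<And>v. v \<noteq> y' \<Longrightarrow> v \<noteq> z' \<Longrightarrow> \<beta> v = 0"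
    using edge.prems(3) edge.hyps(2) by (auto simp: boundary_on_def)
  have "\<beta> z' = - \<beta> y'" using sum0 by (metis add.inverse_unique)
  then have "\<beta> v = 0 + \<beta> y' * edge_vec y' z' v" for v
    using edge.hyps(2) out[of v] by (auto simp: edge_vec_def)
  then have "contracted_net ends {} y' z' \<beta>"
    unfolding contracted_net_def using orientable_empty by blast
  moreover have "{e'} - {e} = {}" using edge by auto
  ultimately show ?case using contracted_net_ends edge by (metis singletonD)
next
  case (add_vertex V E x e' y' z' f g)
  note wf = two_tree_wf[OF add_vertex.hyps(1)]
  then have yz: "y' \<in> V" "z' \<in> V" using add_vertex.hyps by auto
  then have ne: "x \<noteq> y'" "x \<noteq> z'" using add_vertex.hyps by auto
  have fg: "f \<notin> E" "g \<notin> E" "f \<noteq> g" using wf add_vertex.hyps ne by (auto simp: doubleton_eq_iff)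
  have \<beta>0: "\<beta> x + sum \<beta> V = 0" "\<And>v. v \<noteq> x \<Longrightarrow> v \<notin> V \<Longrightarrow> \<beta> v = 0"
    using add_vertex.prems(3) add_vertex.hyps(2) wf by (auto simp: boundary_on_def)
  \<comment> \<open>Either new edge may be the contracted one, hence the free choice of
    \<open>p\<close> and \<open>q\<close>: the edge \<open>xp\<close> is contracted and
    \<open>k\<close> survives.\<close>
  have pend: "contracted_net ends (insert k E) x p \<beta>"
    if "{p, q} = {y', z'}" "p \<noteq> q" "k \<notin> E" "ends k = {x, q}" for p q k
  proof (rule contracted_net_pendant_edge)
    have p: "p \<in> V" using that yz by (auto simp: doubleton_eq_iff)
    have "sum (\<lambda>v. if v = x then 0 else if v = p then \<beta> p + \<beta> x else \<beta> v) V
        = sum (\<lambda>v. \<beta> v + (if v = p then \<beta> x else 0)) V"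
      using add_vertex.hyps(2) by (intro sum.cong) auto
    also have "\<dots> = 0" using p wf \<beta>0 by (simp add: sum.distrib add.commute)
    finally show "contracted_net ends (E - {e'}) p q
        (\<lambda>v. if v = x then 0 else if v = p then \<beta> p + \<beta> x else \<beta> v)"
      using add_vertex that p \<beta>0(2) by (intro add_vertex.IH) (auto simp: boundary_on_def)
  qed (use that add_vertex ne in \<open>auto simp: doubleton_eq_iff\<close>)
  consider "e \<in> E" | "e = f" | "e = g" using add_vertex.prems by auto
  then show ?case
  proof cases
    case 1
    obtain a b where ab: "a \<in> {1, -1}" "b \<in> {1, -1}" "\<beta> x = a + b" by (rule z3_sum_of_signs)
    let ?\<beta> = "\<lambda>v. \<beta> v - (a * edge_vec x y' v + b * edge_vec x z' v)"
    have bnd: "boundary_on (insert x V) ?\<beta>"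
      using wf yz add_vertex.prems(3)
      by (intro boundary_on_diff boundary_on_add boundary_on_mult boundary_on_edge_vec) auto
    have zero: "?\<beta> x = 0" using ab ne by (simp add: edge_vec_def)
    have "boundary_on V ?\<beta>"
      by (rule boundary_on_remove[OF bnd _ add_vertex.hyps(2) zero]) (use wf in simp)
    from add_vertex.IH[OF 1 add_vertex.prems(2) this] obtain c \<gamma>
      where on: "orientable ends (E - {e}) \<gamma>" and eq: "\<And>v. ?\<beta> v = \<gamma> v + c * edge_vec y z v"
      unfolding contracted_net_def by blast
    have "orientable ends (insert g (E - {e})) (\<lambda>v. \<gamma> v + b * edge_vec x z' v)"
      by (rule orientable_insert[where ends = ends, OF add_vertex.hyps(7) on _ ne(2) ab(2)]) (use fg in auto)
    then have on': "orientable ends (insert f (insert g (E - {e})))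
        (\<lambda>v. \<gamma> v + b * edge_vec x z' v + a * edge_vec x y' v)"
      by (rule orientable_insert[where ends = ends, OF add_vertex.hyps(6) _ _ ne(1) ab(1)]) (use fg in auto)
    have "insert f (insert g E) - {e} = insert f (insert g (E - {e}))"
      using 1 fg by auto
    moreover have "\<beta> v = \<gamma> v + b * edge_vec x z' v + a * edge_vec x y' v + c * edge_vec y z v" for v
      using eq[of v] by (simp add: algebra_simps)
    ultimately show ?thesis using contracted_netI[OF on'] by simp
  next
    case 2
    then have "insert f (insert g E) - {e} = insert g E" using fg by auto
    moreover have "contracted_net ends (insert g E) x y' \<beta>"
      using pend[of y' z' g] add_vertex.hyps fg by auto
    ultimately show ?thesis using contracted_net_ends 2 add_vertex by metis
  next
    case 3
    then have "insert f (insert g E) - {e} = insert f E" using fg by auto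
    moreover have "contracted_net ends (insert f E) x z' \<beta>"
      using pend[of z' y' f] add_vertex.hyps fg by auto
    ultimately show ?thesis using contracted_net_ends 3 add_vertex by metis
  qed
qed

section \<open>Triangle coordinates and the boundaries that a tree may miss\<close>

lemma z3_nonzero: "x \<noteq> 0 \<Longrightarrow> x \<in> {1, -1}" "x \<noteq> 0 \<Longrightarrow> - x \<in> {1, -1}" for x :: 3
  by (cases x rule: z3_cases; simp)+

lemma z3_double: "x + x = - x" for x :: 3
  by (cases x rule: z3_cases) auto

definition triangle_comb :: "'a set set \<Rightarrow> ('a set \<Rightarrow> 3) \<Rightarrow> 'a \<Rightarrow> 3" where
  "triangle_comb \<T> \<epsilon> v = (\<Sum>t\<in>\<T>. \<epsilon> t * of_bool (v \<in> t))"

lemma triangle_comb_insert: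
  "finite \<T> \<Longrightarrow> t \<notin> \<T> \<Longrightarrow>
    triangle_comb (insert t \<T>) \<epsilon> v = \<epsilon> t * of_bool (v \<in> t) + triangle_comb \<T> \<epsilon> v"
  by (simp add: triangle_comb_def)

lemma triangle_comb_cong:
  "(\<And>t. t \<in> \<T> \<Longrightarrow> \<epsilon> t = \<delta> t) \<Longrightarrow> triangle_comb \<T> \<epsilon> v = triangle_comb \<T> \<delta> v"
  by (simp add: triangle_comb_def)

lemma triangle_comb_outside:
  "(\<And>t. t \<in> \<T> \<Longrightarrow> v \<notin> t) \<Longrightarrow> triangle_comb \<T> \<epsilon> v = 0"
  by (simp add: triangle_comb_def)

lemma triangle_comb_diff:
  "triangle_comb \<T> (\<lambda>t. \<epsilon> t - \<delta> t) v = triangle_comb \<T> \<epsilon> v - triangle_comb \<T> \<delta> v"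
  by (simp add: triangle_comb_def sum_subtractf left_diff_distrib)

lemma triangle_comb_superset:
  assumes "finite \<T>" "\<S> \<subseteq> \<T>" "\<And>t. t \<in> \<T> - \<S> \<Longrightarrow> \<epsilon> t = 0"
  shows "triangle_comb \<S> \<epsilon> v = triangle_comb \<T> \<epsilon> v"
  unfolding triangle_comb_def using assms by (intro sum.mono_neutral_left) auto

definition triangles_indep :: "'a set set \<Rightarrow> bool" where
  "triangles_indep \<T> \<longleftrightarrow>
    (\<forall>\<epsilon>. (\<forall>v. triangle_comb \<T> \<epsilon> v = 0) \<longrightarrow> (\<forall>t\<in>\<T>. \<epsilon> t = 0))"

text \<open>The difference of two coordinate vectors on \<open>\<S>\<close>, extended by zero, is a
  relation on \<open>\<T>\<close>; so coordinates are unique on every subfamily.\<close>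

lemma triangles_indep_unique:
  assumes "triangles_indep \<T>" "finite \<T>" "\<S> \<subseteq> \<T>"
    and eq: "\<And>v. triangle_comb \<S> \<epsilon> v = triangle_comb \<S> \<delta> v" and "t \<in> \<S>"
  shows "\<epsilon> t = \<delta> t"
proof -
  let ?c = "\<lambda>t. if t \<in> \<S> then \<epsilon> t - \<delta> t else 0"
  have "triangle_comb \<T> ?c v = 0" for v
  proof -
    have "triangle_comb \<T> ?c v = triangle_comb \<S> ?c v"
      using triangle_comb_superset[OF assms(2,3), of ?c] by auto
    also have "\<dots> = triangle_comb \<S> (\<lambda>t. \<epsilon> t - \<delta> t) v"
      by (intro triangle_comb_cong) auto
    finally show ?thesis using eq by (simp add: triangle_comb_diff)
  qed
  then have "?c t = 0" using assms(1,3,5) unfolding triangles_indep_def by blast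
  then show ?thesis using assms(5) by simp
qed

text \<open>Full support, with all coordinates 1 or -1: the shape of every boundary that a two-tree
  fails to realize.\<close>

definition full_comb :: "'a set set \<Rightarrow> ('a \<Rightarrow> 3) \<Rightarrow> bool" where
  "full_comb \<T> \<beta> \<longleftrightarrow> (\<exists>\<epsilon>. (\<forall>t\<in>\<T>. \<epsilon> t \<noteq> 0) \<and> (\<forall>v. \<beta> v = triangle_comb \<T> \<epsilon> v))"

text \<open>Inductive step of the dichotomy. If \<open>\<beta> x = 0\<close>, the path through
  \<open>x\<close> and the edge \<open>e\<close> form a parallel pair carrying any flow between
  \<open>y\<close> and \<open>z\<close>, so contractibility suffices. Otherwise both new edges are
  forced, and a failure on \<open>V\<close> acquires the nonzero coordinate \<open>\<beta> x\<close>
  at the new triangle.\<close>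

lemma full_comb_add_vertex:
  assumes fin: "finite V" "finite \<T>" and \<T>: "\<forall>t\<in>\<T>. t \<subseteq> V"
    and dich: "\<And>\<beta>. boundary_on V \<beta> \<Longrightarrow> orientable ends E \<beta> \<or> full_comb \<T> \<beta>"
    and contr: "\<And>\<beta>. boundary_on V \<beta> \<Longrightarrow> contracted_net ends (E - {e}) y z \<beta>"
    and x: "x \<notin> V" and e: "e \<in> E" "ends e = {y, z}" and ne: "y \<noteq> z" and yz: "y \<in> V" "z \<in> V"
    and fg: "ends f = {x, y}" "ends g = {x, z}" "f \<notin> E" "g \<notin> E"
    and \<beta>: "boundary_on (insert x V) \<beta>"
  shows "orientable ends (insert f (insert g E)) \<beta> \<or> full_comb (insert {x, y, z} \<T>) \<beta>"
proof -
  have xy: "x \<noteq> y" "x \<noteq> z" using x yz by auto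
  have "f \<noteq> g" using fg ne xy by (auto simp: doubleton_eq_iff)
  have extend: "orientable ends (insert f (insert g E)) \<beta>"
    if "orientable ends E \<gamma>" "a \<in> {1, -1}" "b \<in> {1, -1}"
      "\<And>v. \<beta> v = \<gamma> v + b * edge_vec x z v + a * edge_vec x y v" for \<gamma> a b
  proof -
    have "orientable ends (insert g E) (\<lambda>v. \<gamma> v + b * edge_vec x z v)"
      by (rule orientable_insert[where ends = ends, OF fg(2) that(1) fg(4) xy(2) that(3)]) auto
    then show ?thesis
      by (rule orientable_insert[where ends = ends, OF fg(1) _ _ xy(1) that(2) that(4)])
        (use fg \<open>f \<noteq> g\<close> in auto)
  qed
  show ?thesis
  proof (cases "\<beta> x = 0")
    case True
    then have "contracted_net ends (E - {e}) y z \<beta>"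
      using boundary_on_remove[OF \<beta> fin(1) x] contr by blast
    then obtain c \<gamma> where on: "orientable ends (E - {e}) \<gamma>"
      and eq: "\<And>v. \<beta> v = \<gamma> v + c * edge_vec y z v"
      unfolding contracted_net_def by blast
    \<comment> \<open>The edge \<open>e\<close> carries \<open>a\<close>, while \<open>g\<close>
      with sign \<open>b\<close> and \<open>f\<close> with sign \<open>-b\<close> cancel at
      \<open>x\<close> and carry \<open>b\<close> from \<open>y\<close> to \<open>z\<close>.\<close>
    obtain a b where ab: "a \<in> {1, -1}" "b \<in> {1, -1}" "c = a + b" by (rule z3_sum_of_signs)
    have "orientable ends (insert e (E - {e})) (\<lambda>v. \<gamma> v + a * edge_vec y z v)"
      by (rule orientable_insert[where ends = ends, OF e(2) on _ ne ab(1)]) auto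
    then have "orientable ends E (\<lambda>v. \<gamma> v + a * edge_vec y z v)"
      using e(1) by (simp add: insert_absorb)
    moreover have "\<beta> v = \<gamma> v + a * edge_vec y z v + b * edge_vec x z v + (- b) * edge_vec x y v" for v
      using eq[of v] ab(3) by (simp add: edge_vec_def algebra_simps)
    moreover have "- b \<in> {1, -1}" using ab(2) by auto
    ultimately show ?thesis using extend ab(2) by blast
  next
    case False
    define s where "s = \<beta> x"
    then have s: "s \<in> {1, -1}" "- s \<in> {1, -1}" using False z3_nonzero by metis+
    \<comment> \<open>Two signs sum to \<open>s\<close> only if both are \<open>-s\<close>. The two
      edges then contribute \<open>s\<close> at each of \<open>x\<close>, \<open>y\<close>,
      \<open>z\<close>, that is, \<open>s\<close> times the indicator of the new triangle.\<close>
    let ?\<beta> = "\<lambda>v. \<beta> v - (- s * edge_vec x z v + - s * edge_vec x y v)"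
    have bnd: "boundary_on (insert x V) ?\<beta>"
      using fin yz \<beta>
      by (intro boundary_on_diff boundary_on_add boundary_on_mult boundary_on_edge_vec) auto
    have zero: "?\<beta> x = 0" using xy z3_double[of s] by (simp add: edge_vec_def s_def)
    have "boundary_on V ?\<beta>" by (rule boundary_on_remove[OF bnd fin(1) x zero])
    from dich[OF this] show ?thesis
    proof
      assume "orientable ends E ?\<beta>"
      from extend[OF this s(2) s(2)] show ?thesis by simp
    next
      assume "full_comb \<T> ?\<beta>"
      then obtain \<epsilon> where \<epsilon>: "\<forall>t\<in>\<T>. \<epsilon> t \<noteq> 0" "\<And>v. ?\<beta> v = triangle_comb \<T> \<epsilon> v"
        unfolding full_comb_def by blast
      let ?t = "{x, y, z}"
      have t: "?t \<notin> \<T>" using \<T> x by auto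
      have "\<beta> v = triangle_comb (insert ?t \<T>) (\<epsilon>(?t := s)) v" for v
      proof -
        have "triangle_comb \<T> (\<epsilon>(?t := s)) v = triangle_comb \<T> \<epsilon> v"
          using t by (intro triangle_comb_cong) auto
        then have "triangle_comb (insert ?t \<T>) (\<epsilon>(?t := s)) v = s * of_bool (v \<in> ?t) + ?\<beta> v"
          using t fin \<epsilon>(2)[of v] by (simp add: triangle_comb_insert)
        also have "\<dots> = \<beta> v"
          using xy ne z3_double[of s] by (simp add: edge_vec_def)
        finally show ?thesis by simp
      qed
      moreover have "\<forall>t\<in>insert ?t \<T>. (\<epsilon>(?t := s)) t \<noteq> 0" using \<epsilon>(1) s(1) by auto
      ultimately show ?thesis unfolding full_comb_def by blast
    qed
  qed
qed

text \<open>Each new vertex adds one triangle, at that moment the only one containing it, which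
  yields both the count and the independence. The clause on pairs of triangle vertices serves to
  recover the tree from its triangles when there are four vertices.\<close>

lemma two_tree_triangles:
  assumes "two_tree ends V E"
  shows "\<exists>\<T>. finite \<T> \<and> card \<T> + 2 = card V \<and> triangles_indep \<T> \<and>
    (\<forall>t\<in>\<T>. card t = 3 \<and> t \<subseteq> V \<and> (\<forall>p\<in>t. \<forall>q\<in>t. p \<noteq> q \<longrightarrow> (\<exists>e\<in>E. ends e = {p, q}))) \<and>
    (\<forall>\<beta>. boundary_on V \<beta> \<longrightarrow> orientable ends E \<beta> \<or> full_comb \<T> \<beta>)"
  using assms
proof induction
  case (edge e y z)
  \<comment> \<open>Without triangles, \<open>full_comb\<close> means the zero vector; any other
    boundary is the edge vector up to sign.\<close>
  have "orientable ends {e} \<beta> \<or> full_comb {} \<beta>" if "boundary_on {y, z} \<beta>" for \<beta>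
  proof (cases "\<beta> y = 0")
    case True
    then have "\<beta> v = 0" for v
      using that edge by (cases "v = y"; cases "v = z") (auto simp: boundary_on_def)
    then show ?thesis by (auto simp: full_comb_def triangle_comb_def)
  next
    case False
    have sum0: "\<beta> y + \<beta> z = 0" and out: "\<And>v. v \<noteq> y \<Longrightarrow> v \<noteq> z \<Longrightarrow> \<beta> v = 0"
      using that edge.hyps(2) by (auto simp: boundary_on_def)
    have "\<beta> z = - \<beta> y" using sum0 by (metis add.inverse_unique)
    then have eq: "\<beta> v = 0 + \<beta> y * edge_vec y z v" for v
      using edge.hyps(2) out[of v] by (auto simp: edge_vec_def)
    have sign: "\<beta> y \<in> {1, -1}" using False by (rule z3_nonzero)
    have "orientable ends {e} \<beta>"
      by (rule orientable_insert[where ends = ends, OF edge.hyps(1) orientable_empty _ edge.hyps(2) sign eq]) auto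
    then show ?thesis by simp
  qed
  then show ?case using edge by (intro exI[of _ "{}"]) (auto simp: triangles_indep_def)
next
  case (add_vertex V E x e y z f g)
  note wf = two_tree_wf[OF add_vertex.hyps(1)]
  then have yz: "y \<in> V" "z \<in> V" using add_vertex.hyps by auto
  have fg: "f \<notin> E" "g \<notin> E" using wf add_vertex.hyps by auto
  from add_vertex.IH obtain \<T> where \<T>: "finite \<T>" "card \<T> + 2 = card V" "triangles_indep \<T>"
    and tri': "\<forall>t\<in>\<T>. card t = 3 \<and> t \<subseteq> V \<and>
      (\<forall>p\<in>t. \<forall>q\<in>t. p \<noteq> q \<longrightarrow> (\<exists>e\<in>E. ends e = {p, q}))"
    and dich: "\<forall>\<beta>. boundary_on V \<beta> \<longrightarrow> orientable ends E \<beta> \<or> full_comb \<T> \<beta>"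
    by (elim exE conjE) (rule that)
  have tri: "\<And>t. t \<in> \<T> \<Longrightarrow> card t = 3" "\<And>t. t \<in> \<T> \<Longrightarrow> t \<subseteq> V"
      "\<And>t p q. t \<in> \<T> \<Longrightarrow> p \<in> t \<Longrightarrow> q \<in> t \<Longrightarrow> p \<noteq> q \<Longrightarrow> \<exists>e\<in>E. ends e = {p, q}"
    using tri' by blast+
  let ?t = "{x, y, z}"
  have t: "?t \<notin> \<T>" using tri(2) add_vertex.hyps(2) by auto
  have "triangles_indep (insert ?t \<T>)"
    unfolding triangles_indep_def
  proof (intro allI impI)
    fix \<epsilon> assume 0: "\<forall>v. triangle_comb (insert ?t \<T>) \<epsilon> v = 0"
    have "triangle_comb \<T> \<epsilon> x = 0" using tri(2) add_vertex.hyps(2) by (intro triangle_comb_outside) auto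
    then have "\<epsilon> ?t = 0" using 0[rule_format, of x] t \<T>(1) by (simp add: triangle_comb_insert)
    moreover from this have "\<forall>v. triangle_comb \<T> \<epsilon> v = 0" using 0 t \<T>(1) by (simp add: triangle_comb_insert)
    ultimately show "\<forall>t\<in>insert ?t \<T>. \<epsilon> t = 0" using \<T>(3) unfolding triangles_indep_def by blast
  qed
  moreover have "orientable ends (insert f (insert g E)) \<beta> \<or> full_comb (insert ?t \<T>) \<beta>"
    if "boundary_on (insert x V) \<beta>" for \<beta>
  proof (rule full_comb_add_vertex)
    show "orientable ends E \<beta> \<or> full_comb \<T> \<beta>" if "boundary_on V \<beta>" for \<beta>
      using dich that by blast
    show "contracted_net ends (E - {e}) y z \<beta>" if "boundary_on V \<beta>" for \<beta>
      using two_tree_contracted_net[OF add_vertex.hyps(1,3,4) that] .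
  qed (use wf \<T>(1) tri(2) add_vertex.hyps yz fg that in simp_all)
  moreover have "\<exists>e'\<in>insert f (insert g E). ends e' = {p, q}"
    if "p \<in> ?t" "q \<in> ?t" "p \<noteq> q" for p q
    using that add_vertex.hyps(3,4,6,7) by (auto simp: insert_commute)
  moreover have "card ?t = 3" using add_vertex.hyps yz by (auto simp: card_insert_if)
  moreover have "card (insert ?t \<T>) + 2 = card (insert x V)"
    using t \<T>(1,2) wf add_vertex.hyps(2) by simp
  ultimately show ?case
    using \<T>(1) tri yz
    by (intro exI[of _ "insert ?t \<T>"]) (simp, blast)
qed

section \<open>Signed sums of edge vectors in triangle coordinates\<close>

text \<open>The vectors form a list because several vertices may be attached to the same pair, which
  then counts repeatedly.\<close>

fun signed_sums :: "('a \<times> 'a) list \<Rightarrow> ('a \<Rightarrow> 3) set" where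
  "signed_sums [] = {\<lambda>v. 0}"
| "signed_sums ((y, z) # us) =
    (\<Union>\<gamma>\<in>signed_sums us. {\<lambda>v. \<gamma> v + edge_vec y z v, \<lambda>v. \<gamma> v - edge_vec y z v})"

lemma signed_sums_nonempty: "signed_sums us \<noteq> {}"
  by (induction us rule: signed_sums.induct) auto

text \<open>A triangle has a vertex outside \<open>{y, z}\<close>, where the edge vector vanishes
  but a nonzero multiple of the triangle does not.\<close>

lemma edge_vec_support_ge_2:
  assumes "finite \<S>" "\<forall>t\<in>\<S>. card t = 3" "y \<noteq> z"
    and eq: "\<And>v. edge_vec y z v = triangle_comb \<S> c v"
  shows "2 \<le> card {t \<in> \<S>. c t \<noteq> 0}"
proof (rule ccontr)
  let ?S = "{t \<in> \<S>. c t \<noteq> 0}"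
  assume "\<not> 2 \<le> card ?S"
  then have "card ?S = 0 \<or> card ?S = 1" by auto
  moreover have eq': "edge_vec y z v = triangle_comb ?S c v" for v
    unfolding eq using assms(1) by (intro triangle_comb_superset[symmetric]) auto
  moreover have "edge_vec y z y = 1" using assms(3) by (simp add: edge_vec_def)
  moreover have "?S \<noteq> {}"
  proof
    assume empty: "?S = {}"
    have "edge_vec y z y = 0" unfolding eq' empty by (simp add: triangle_comb_def)
    then show False using \<open>edge_vec y z y = 1\<close> by simp
  qed
  ultimately obtain t where t: "?S = {t}" using assms(1) by (auto simp: card_1_singleton_iff)
  then have "t \<in> \<S>" "c t \<noteq> 0" by auto
  have "\<not> t \<subseteq> {y, z}"
  proof
    assume "t \<subseteq> {y, z}"
    then have "card t \<le> card {y, z}" by (intro card_mono) auto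
    also have "\<dots> \<le> 2" by (simp add: card_insert_if)
    finally show False using assms(2) \<open>t \<in> \<S>\<close> by auto
  qed
  then obtain v where "v \<in> t" "v \<noteq> y" "v \<noteq> z" by auto
  then show False using eq'[of v] t \<open>c t \<noteq> 0\<close> by (simp add: triangle_comb_def edge_vec_def)
qed

text \<open>Each list entry uses up the coordinates in its own support, at least two of them, and
  leaves full support on the rest. In the case of equality nothing remains at the end of the list,
  and the empty combination is zero.\<close>

lemma signed_sums_full_comb:
  assumes indep: "triangles_indep \<T>" and fin: "finite \<T>" and tri: "\<forall>t\<in>\<T>. card t = 3"
    and "\<S> \<subseteq> \<T>" "\<forall>(y, z)\<in>set us. y \<noteq> z"
    and "\<And>\<gamma>. \<gamma> \<in> signed_sums us \<Longrightarrow> full_comb \<S> (\<lambda>v. \<beta> v - \<gamma> v)"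
  shows "2 * length us \<le> card \<S> \<and> (2 * length us = card \<S> \<longrightarrow> \<beta> = (\<lambda>v. 0))"
  using assms(4-)
proof (induction us arbitrary: \<S> rule: signed_sums.induct)
  case 1
  have "finite \<S>" by (rule finite_subset[OF 1(1) fin])
  then show ?case using 1(3) by (auto simp: full_comb_def triangle_comb_def)
next
  case (2 y z us)
  have finS: "finite \<S>" by (rule finite_subset[OF 2(2) fin])
  \<comment> \<open>Here \<open>\<epsilon>\<close> and \<open>\<delta>\<close> are the coordinates
    for the two signs of the first vector. As 2 = -1, their difference gives that vector, and the
    negative of their sum gives \<open>\<beta> - \<gamma>\<close>.\<close>
  have split: "\<exists>\<epsilon> \<delta>. (\<forall>t\<in>\<S>. \<epsilon> t \<noteq> 0 \<and> \<delta> t \<noteq> 0) \<and>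
      (\<forall>v. edge_vec y z v = triangle_comb \<S> (\<lambda>t. \<epsilon> t - \<delta> t) v) \<and>
      (\<forall>v. \<beta> v - \<gamma> v = triangle_comb \<S> (\<lambda>t. - \<epsilon> t - \<delta> t) v)"
    if \<gamma>: "\<gamma> \<in> signed_sums us" for \<gamma>
  proof -
    have "full_comb \<S> (\<lambda>v. \<beta> v - (\<gamma> v + edge_vec y z v))"
      "full_comb \<S> (\<lambda>v. \<beta> v - (\<gamma> v - edge_vec y z v))"
      using 2(4) \<gamma> by auto
    then obtain \<epsilon> \<delta> where nz: "\<forall>t\<in>\<S>. \<epsilon> t \<noteq> 0" "\<forall>t\<in>\<S>. \<delta> t \<noteq> 0"
      and e: "\<And>v. \<beta> v - (\<gamma> v + edge_vec y z v) = triangle_comb \<S> \<epsilon> v"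
      and d: "\<And>v. \<beta> v - (\<gamma> v - edge_vec y z v) = triangle_comb \<S> \<delta> v"
      unfolding full_comb_def by blast
    have "edge_vec y z v = triangle_comb \<S> (\<lambda>t. \<epsilon> t - \<delta> t) v" for v
      unfolding triangle_comb_diff e[symmetric] d[symmetric]
      using z3_double[of "edge_vec y z v"] by (simp add: algebra_simps)
    moreover have "\<beta> v - \<gamma> v = triangle_comb \<S> (\<lambda>t. - \<epsilon> t - \<delta> t) v" for v
    proof -
      have "triangle_comb \<S> (\<lambda>t. - \<epsilon> t - \<delta> t) v = - triangle_comb \<S> \<epsilon> v - triangle_comb \<S> \<delta> v"
        by (simp add: triangle_comb_def sum_subtractf left_diff_distrib sum_negf)
      also have "\<dots> = - ((\<beta> v - \<gamma> v) + (\<beta> v - \<gamma> v))"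
        unfolding e[symmetric] d[symmetric] by simp
      finally show ?thesis unfolding z3_double by simp
    qed
    ultimately show ?thesis using nz by blast
  qed
  \<comment> \<open>Any one \<open>\<gamma>0\<close> serves: by uniqueness of coordinates
    \<open>c\<close>, and with it \<open>?S\<close>, is the same for all
    \<open>\<gamma>\<close>.\<close>
  obtain \<gamma>0 where "\<gamma>0 \<in> signed_sums us" using signed_sums_nonempty by blast
  from split[OF this] obtain c where c: "\<And>v. edge_vec y z v = triangle_comb \<S> c v" by blast
  let ?S = "{t \<in> \<S>. c t \<noteq> 0}"
  have S2: "2 \<le> card ?S"
    by (rule edge_vec_support_ge_2[OF finS _ _ c]) (use 2(2,3) tri in auto)
  have "full_comb (\<S> - ?S) (\<lambda>v. \<beta> v - \<gamma> v)" if \<gamma>: "\<gamma> \<in> signed_sums us" for \<gamma>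
  proof -
    from split[OF \<gamma>] obtain \<epsilon> \<delta> where nz: "\<And>t. t \<in> \<S> \<Longrightarrow> \<epsilon> t \<noteq> 0 \<and> \<delta> t \<noteq> 0"
      and u: "\<And>v. edge_vec y z v = triangle_comb \<S> (\<lambda>t. \<epsilon> t - \<delta> t) v"
      and b: "\<And>v. \<beta> v - \<gamma> v = triangle_comb \<S> (\<lambda>t. - \<epsilon> t - \<delta> t) v"
      by blast
    have ce: "c t = \<epsilon> t - \<delta> t" if "t \<in> \<S>" for t
      using triangles_indep_unique[OF indep fin 2(2) _ that, of c "\<lambda>t. \<epsilon> t - \<delta> t"] c u by metis
    \<comment> \<open>In \<open>\<int>/3\<int>\<close>, adding and subtracting \<open>c t \<noteq> 0\<close> leaves a value nonzero only if that value is 0.\<close>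
    have zero: "- \<epsilon> t - \<delta> t = 0 \<longleftrightarrow> c t \<noteq> 0" if "t \<in> \<S>" for t
      using nz[OF that] ce[OF that]
      by (cases "\<epsilon> t" rule: z3_cases; cases "\<delta> t" rule: z3_cases) auto
    have "\<beta> v - \<gamma> v = triangle_comb (\<S> - ?S) (\<lambda>t. - \<epsilon> t - \<delta> t) v" for v
      unfolding b using zero by (intro triangle_comb_superset[symmetric] finS) auto
    moreover have "\<forall>t\<in>\<S> - ?S. - \<epsilon> t - \<delta> t \<noteq> 0" using zero by auto
    ultimately show ?thesis
      unfolding full_comb_def by (intro exI[of _ "\<lambda>t. - \<epsilon> t - \<delta> t"]) simp
  qed
  then have "2 * length us \<le> card (\<S> - ?S) \<and> (2 * length us = card (\<S> - ?S) \<longrightarrow> \<beta> = (\<lambda>v. 0))"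
    using 2(2,3) by (intro 2(1)) auto
  moreover have "card (\<S> - ?S) + card ?S = card \<S>"
    using finS by (simp add: card_Diff_subset card_mono)
  ultimately show ?case using S2 by auto
qed

section \<open>Strongly connected orientations\<close>

definition strongly_orientable ::
    "('e \<Rightarrow> 'a set) \<Rightarrow> 'a set \<Rightarrow> 'e set \<Rightarrow> ('a \<Rightarrow> 3) \<Rightarrow> bool" where
  "strongly_orientable ends V E \<beta> \<longleftrightarrow>
    (\<exists>A. oriented_net ends E A \<beta> \<and> V \<times> V \<subseteq> A\<^sup>*)"

text \<open>Paths to and from a single hub \<open>p\<close> compose to paths between all
  pairs.\<close>

lemma strongly_orientableI:
  assumes "oriented_net ends E A \<gamma>" "\<And>v. \<beta> v = \<gamma> v"
    and "\<And>v. v \<in> V \<Longrightarrow> (p, v) \<in> A\<^sup>* \<and> (v, p) \<in> A\<^sup>*"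
  shows "strongly_orientable ends V E \<beta>"
proof -
  have "\<beta> = \<gamma>" using assms(2) by auto
  moreover have "V \<times> V \<subseteq> A\<^sup>*" using assms(3) by (auto intro: rtrancl_trans)
  ultimately show ?thesis using assms(1) unfolding strongly_orientable_def by blast
qed

lemma strongly_orientable_union:
  assumes "strongly_orientable ends V E \<beta>" "orientable ends F \<gamma>" "E \<inter> F = {}"
  shows "strongly_orientable ends V (E \<union> F) (\<lambda>v. \<beta> v + \<gamma> v)"
proof -
  from assms obtain A B where AB: "oriented_net ends E A \<beta>" "V \<times> V \<subseteq> A\<^sup>*" "oriented_net ends F B \<gamma>"
    unfolding strongly_orientable_def orientable_def by blast
  have "A\<^sup>* \<subseteq> (A \<union> B)\<^sup>*" by (intro rtrancl_mono) auto
  then show ?thesis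
    using oriented_net_union[OF AB(1,3) assms(3)] AB(2) unfolding strongly_orientable_def by blast
qed

text \<open>The directed path from \<open>y\<close> through \<open>x\<close> to \<open>z\<close> is
  balanced at \<open>x\<close>, so it adds exactly the edge vector; the old orientation leads back
  from \<open>z\<close> to \<open>y\<close>.\<close>

lemma strongly_orientable_add_path:
  assumes "strongly_orientable ends V E \<gamma>" "y \<in> V" "z \<in> V" "x \<notin> V"
    and fg: "ends f = {x, y}" "ends g = {x, z}" "f \<notin> E" "g \<notin> E" "f \<noteq> g"
    and eq: "\<And>v. \<beta> v = \<gamma> v + edge_vec y z v"
  shows "strongly_orientable ends (insert x V) (insert f (insert g E)) \<beta>"
proof -
  from assms(1) obtain A where A: "oriented_net ends E A \<gamma>" "V \<times> V \<subseteq> A\<^sup>*"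
    unfolding strongly_orientable_def by blast
  have xyz: "y \<noteq> x" "x \<noteq> z" using assms by auto
  have on: "oriented_net ends (insert g E) (insert (x, z) A) (\<lambda>v. \<gamma> v + edge_vec x z v)"
    using oriented_net.insert[OF A(1) fg(4) fg(2) xyz(2)] .
  have "ends f = {y, x}" using fg(1) by auto
  then have "oriented_net ends (insert f (insert g E)) (insert (y, x) (insert (x, z) A))
      (\<lambda>v. \<gamma> v + edge_vec x z v + edge_vec y x v)"
    using oriented_net.insert[OF on, of f y x] fg xyz by auto
  then show ?thesis
  proof (rule strongly_orientableI[where p = y])
    show "\<beta> v = \<gamma> v + edge_vec x z v + edge_vec y x v" for v
      using eq[of v] by (simp add: edge_vec_def)
  next
    let ?B = "insert (y, x) (insert (x, z) A)"
    have V: "(u, v) \<in> ?B\<^sup>*" if "u \<in> V" "v \<in> V" for u v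
    proof -
      have "A\<^sup>* \<subseteq> ?B\<^sup>*" by (intro rtrancl_mono) auto
      then show ?thesis using that A(2) by auto
    qed
    have "(y, x) \<in> ?B\<^sup>*" "(x, z) \<in> ?B\<^sup>*" by auto
    moreover from this(2) V[OF assms(3,2)] have "(x, y) \<in> ?B\<^sup>*" by (rule rtrancl_trans)
    ultimately show "(y, v) \<in> ?B\<^sup>* \<and> (v, y) \<in> ?B\<^sup>*" if "v \<in> insert x V" for v
      using V assms(2) that by auto
  qed
qed

section \<open>Diamonds, and signed sums realized by strong orientations\<close>

text \<open>The complete graph on four vertices minus the edge \<open>rs\<close>, so
  \<open>pq\<close> is the common edge of its two triangles. The five edges are distinct because
  their ends are.\<close>

definition diamond ::
    "('e \<Rightarrow> 'a set) \<Rightarrow> 'a set \<Rightarrow> 'e set \<Rightarrow> 'a \<Rightarrow> 'a \<Rightarrow> 'a \<Rightarrow> 'a \<Rightarrow> bool" where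
  "diamond ends V E p q r s \<longleftrightarrow> distinct [p, q, r, s] \<and> V = {p, q, r, s} \<and>
    (\<exists>e h k f g. E = {e, h, k, f, g} \<and> ends e = {p, q} \<and>
      ends h = {p, r} \<and> ends k = {q, r} \<and> ends f = {p, s} \<and> ends g = {q, s})"

lemma diamond_swap:
  assumes "diamond ends V E p q r s"
  shows "diamond ends V E q p r s"
proof -
  from assms obtain e h k f g where "distinct [p, q, r, s]" "V = {p, q, r, s}"
    and "E = {e, h, k, f, g}"
    and "ends e = {p, q}" "ends h = {p, r}" "ends k = {q, r}" "ends f = {p, s}" "ends g = {q, s}"
    unfolding diamond_def by blast
  then have "distinct [q, p, r, s]" "V = {q, p, r, s}" "E = {e, k, h, g, f}" "ends e = {q, p}"
    by auto
  with \<open>ends h = _\<close> \<open>ends k = _\<close> \<open>ends f = _\<close> \<open>ends g = _\<close> show ?thesis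
    unfolding diamond_def by blast
qed

text \<open>Allows an explicit orientation to be given as a list of triples of edge, tail and
  head.\<close>

lemma oriented_net_list:
  assumes "distinct (map fst xs)" "\<forall>(e, y, z)\<in>set xs. ends e = {y, z} \<and> y \<noteq> z"
  shows "oriented_net ends (fst ` set xs) (snd ` set xs) (\<lambda>v. \<Sum>(e, y, z)\<leftarrow>xs. edge_vec y z v)"
  using assms
proof (induction xs)
  case Nil
  then show ?case using oriented_net.empty by simp
next
  case (Cons a xs)
  obtain e y z where a: "a = (e, y, z)" by (cases a)
  have "oriented_net ends (fst ` set xs) (snd ` set xs) (\<lambda>v. \<Sum>(e, y, z)\<leftarrow>xs. edge_vec y z v)"
    using Cons by simp
  from oriented_net.insert[OF this, of e y z] Cons.prems show ?case
    by (simp add: a add.commute)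
qed

lemma diamond_strongly_orientable_pos:
  assumes "diamond ends V E p q r s"
  shows "strongly_orientable ends V E (edge_vec p q)"
proof -
  from assms obtain e h k f g where pqrs: "distinct [p, q, r, s]" "V = {p, q, r, s}"
    and E: "E = {e, h, k, f, g}"
    and ends: "ends e = {p, q}" "ends h = {p, r}" "ends k = {q, r}" "ends f = {p, s}" "ends g = {q, s}"
    unfolding diamond_def by blast
  have dist: "distinct [e, h, k, f, g]" using pqrs(1) ends by (auto simp: doubleton_eq_iff)
  \<comment> \<open>The directed triangle \<open>p\<close>, \<open>q\<close>, \<open>s\<close> is
    balanced, and the path from \<open>p\<close> through \<open>r\<close> to \<open>q\<close>
    contributes the edge vector.\<close>
  let ?xs = "[(e, p, q), (h, p, r), (k, r, q), (f, s, p), (g, q, s)]"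
  let ?A = "{(p, q), (p, r), (r, q), (s, p), (q, s)}"
  have "oriented_net ends (fst ` set ?xs) (snd ` set ?xs) (\<lambda>v. \<Sum>(e, y, z)\<leftarrow>?xs. edge_vec y z v)"
    by (rule oriented_net_list) (use dist ends pqrs(1) in \<open>auto simp: insert_commute\<close>)
  then have "oriented_net ends E ?A (\<lambda>v. \<Sum>(e, y, z)\<leftarrow>?xs. edge_vec y z v)"
    by (simp add: E)
  then show ?thesis
  proof (rule strongly_orientableI[where p = p])
    have a: "(p, q) \<in> ?A\<^sup>*" "(p, r) \<in> ?A\<^sup>*" "(r, q) \<in> ?A\<^sup>*" "(s, p) \<in> ?A\<^sup>*" "(q, s) \<in> ?A\<^sup>*"
      by auto
    then have "(q, p) \<in> ?A\<^sup>*" "(p, s) \<in> ?A\<^sup>*" by (meson rtrancl_trans)+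
    moreover from this have "(r, p) \<in> ?A\<^sup>*" using a by (meson rtrancl_trans)
    ultimately show "(p, v) \<in> ?A\<^sup>* \<and> (v, p) \<in> ?A\<^sup>*" if "v \<in> V" for v
      using a that pqrs(2) by blast
  qed (simp add: edge_vec_def)
qed

lemma diamond_strongly_orientable:
  assumes "diamond ends V E p q r s" "\<gamma> \<in> signed_sums [(p, q)]"
  shows "strongly_orientable ends V E \<gamma>"
proof -
  have "\<gamma> = edge_vec p q \<or> \<gamma> = edge_vec q p"
    using assms(2) by (auto simp: edge_vec_swap[of q p])
  then show ?thesis
    using diamond_strongly_orientable_pos assms(1) diamond_swap by metis
qed

text \<open>A fourth vertex may be attached to any edge of the triangle, so the triangle is
  described from an arbitrary edge \<open>e\<close> and not just from the one it was grown
  from.\<close>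

lemma two_tree_card_3:
  assumes "two_tree ends V E" "card V = 3" "e \<in> E" "ends e = {y, z}"
  shows "\<exists>w h k. w \<noteq> y \<and> w \<noteq> z \<and> V = {y, z, w} \<and> E = {e, h, k} \<and> ends h = {y, w} \<and> ends k = {z, w}"
  using assms(1)
proof cases
  case (edge y z e)
  then show ?thesis using assms(2) by simp
next
  case (add_vertex V' E' x e' p q f g)
  then have "card V' = 2" using assms(2) two_tree_wf[OF add_vertex(3)] by simp
  from add_vertex(3) have "V' = {p, q} \<and> E' = {e'}"
  proof cases
    case (edge y z e)
    then show ?thesis using add_vertex by auto
  next
    case (add_vertex V E x e y z f g)
    then show ?thesis using \<open>card V' = 2\<close> two_tree_wf[OF add_vertex(3)] by simp
  qed
  then have V: "V = {x, p, q}" "E = {f, g, e'}" using add_vertex by auto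
  have x: "x \<noteq> p" "x \<noteq> q" using \<open>V' = {p, q} \<and> E' = {e'}\<close> add_vertex by auto
  have ends: "ends f = {x, p}" "ends g = {x, q}" "ends e' = {p, q}" "p \<noteq> q" using add_vertex by auto
  have result: ?thesis if "V = {y, z, w}" "E = {e, h, k}" "ends h = {y, w}" "ends k = {z, w}"
    "w \<noteq> y" "w \<noteq> z" for w h k
    using that by blast
  consider "e = e'" | "e = f" | "e = g" using assms(3) V by auto
  then show ?thesis
  proof cases
    case 1
    then have "y = p \<and> z = q \<or> y = q \<and> z = p" using ends assms(4) by (auto simp: doubleton_eq_iff)
    then show ?thesis
    proof
      assume "y = p \<and> z = q"
      then show ?thesis
        by (intro result[of x f g]) (use 1 V x ends in \<open>simp_all add: insert_commute\<close>)
    next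
      assume "y = q \<and> z = p"
      then show ?thesis
        by (intro result[of x g f]) (use 1 V x ends in \<open>simp_all add: insert_commute\<close>)
    qed
  next
    case 2
    then have "y = x \<and> z = p \<or> y = p \<and> z = x" using ends assms(4) by (auto simp: doubleton_eq_iff)
    then show ?thesis
    proof
      assume "y = x \<and> z = p"
      then show ?thesis
        by (intro result[of q g e']) (use 2 V x ends in \<open>simp_all add: insert_commute\<close>)
    next
      assume "y = p \<and> z = x"
      then show ?thesis
        by (intro result[of q e' g]) (use 2 V x ends in \<open>simp_all add: insert_commute\<close>)
    qed
  next
    case 3
    then have "y = x \<and> z = q \<or> y = q \<and> z = x" using ends assms(4) by (auto simp: doubleton_eq_iff)
    then show ?thesis
    proof
      assume "y = x \<and> z = q"
      then show ?thesis
        by (intro result[of p f e']) (use 3 V x ends in \<open>simp_all add: insert_commute\<close>)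
    next
      assume "y = q \<and> z = x"
      then show ?thesis
        by (intro result[of p e' f]) (use 3 V x ends in \<open>simp_all add: insert_commute\<close>)
    qed
  qed
qed

lemma two_tree_card_4:
  assumes "two_tree ends V E" "card V = 4"
  shows "\<exists>p q r s. diamond ends V E p q r s"
  using assms(1)
proof cases
  case (edge y z e)
  then show ?thesis using assms(2) by simp
next
  case (add_vertex V' E' x e p q f g)
  then have "card V' = 3" using assms(2) two_tree_wf[OF add_vertex(3)] by simp
  from two_tree_card_3[OF add_vertex(3) this add_vertex(5,6)] obtain w h k
    where w: "w \<noteq> p" "w \<noteq> q" "V' = {p, q, w}" "E' = {e, h, k}" "ends h = {p, w}" "ends k = {q, w}"
    by blast
  have "V = {p, q, w, x}" "E = {e, h, k, f, g}" using add_vertex w by auto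
  moreover have "distinct [p, q, w, x]" using add_vertex(4,7) w by auto
  moreover have "ends f = {p, x}" "ends g = {q, x}" using add_vertex by auto
  ultimately have "diamond ends V E p q w x"
    unfolding diamond_def using add_vertex(6) w(5,6) by blast
  then show ?thesis by blast
qed

text \<open>The diamond supplies the first vector. Each vertex after the fourth is inserted as a
  directed path in one of two directions, which adds a vector with either sign.\<close>

lemma two_tree_strongly_orientable:
  assumes "two_tree ends V E" "4 \<le> card V"
  shows "\<exists>us. length us + 3 = card V \<and> (\<forall>(y, z)\<in>set us. y \<noteq> z) \<and>
    (\<forall>\<gamma>\<in>signed_sums us. strongly_orientable ends V E \<gamma>)"
  using assms
proof induction
  case (edge e y z)
  then show ?case by simp
next
  case (add_vertex V E x e y z f g)
  note wf = two_tree_wf[OF add_vertex.hyps(1)]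
  show ?case
  \<comment> \<open>The induction hypothesis speaks of at least four vertices, so the step from
    three to four starts the list, with the common edge of the diamond.\<close>
  proof (cases "card V = 3")
    case True
    then have c4: "card (insert x V) = 4" using wf add_vertex.hyps(2) by simp
    have "two_tree ends (insert x V) (insert f (insert g E))"
      using two_tree.add_vertex[OF add_vertex.hyps(1-7)] .
    from two_tree_card_4[OF this c4] obtain p q r s
      where d: "diamond ends (insert x V) (insert f (insert g E)) p q r s" by blast
    then have "p \<noteq> q" by (simp add: diamond_def)
    with d diamond_strongly_orientable[OF d] show ?thesis
      using c4 by (intro exI[of _ "[(p, q)]"]) simp
  next
    case False
    have "card (insert x V) = Suc (card V)" using wf add_vertex.hyps(2) by simp
    then obtain us where us: "length us + 3 = card V" "\<forall>(y, z)\<in>set us. y \<noteq> z"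
      "\<And>\<gamma>. \<gamma> \<in> signed_sums us \<Longrightarrow> strongly_orientable ends V E \<gamma>"
      using add_vertex.IH add_vertex.prems False by auto
    have yz: "y \<in> V" "z \<in> V" using wf add_vertex.hyps by auto
    have fg: "f \<notin> E" "g \<notin> E" "f \<noteq> g"
      using wf add_vertex.hyps by (auto simp: doubleton_eq_iff)
    have "strongly_orientable ends (insert x V) (insert f (insert g E)) \<beta>"
      if \<beta>: "\<beta> \<in> signed_sums ((y, z) # us)" for \<beta>
    proof -
      from \<beta> obtain \<gamma> where \<gamma>: "\<gamma> \<in> signed_sums us"
        and "(\<forall>v. \<beta> v = \<gamma> v + edge_vec y z v) \<or> (\<forall>v. \<beta> v = \<gamma> v + edge_vec z y v)"
        by (auto simp: edge_vec_swap[of z y])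
      from this(2) show ?thesis
      proof
        assume "\<forall>v. \<beta> v = \<gamma> v + edge_vec y z v"
        then show ?thesis
          using strongly_orientable_add_path[OF us(3)[OF \<gamma>] yz add_vertex.hyps(2,6,7) fg] by simp
      next
        assume "\<forall>v. \<beta> v = \<gamma> v + edge_vec z y v"
        then show ?thesis
          using strongly_orientable_add_path[OF us(3)[OF \<gamma>] yz(2,1) add_vertex.hyps(2,7,6) fg(2,1)] fg(3)
          by (simp add: insert_commute)
      qed
    qed
    moreover have "length ((y, z) # us) + 3 = card (insert x V)"
      using us(1) wf add_vertex.hyps(2) by simp
    moreover have "\<forall>(y, z)\<in>set ((y, z) # us). y \<noteq> z" using us(2) add_vertex.hyps(5) by simp
    ultimately show ?thesis by blast
  qed
qed

section \<open>The exceptional case of four vertices\<close>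

text \<open>Every vertex has degree 3 in one diamond and 2 in the other. Outdegree minus indegree is
  thus odd and must be 3 or -3; the orientation chosen gives 3 at \<open>p\<close>, \<open>q\<close>
  and -3 at \<open>r\<close>, \<open>s\<close>.\<close>

lemma opposite_diamonds_strongly_orientable:
  assumes "diamond ends V E p q r s" "diamond ends V F r s p q" "E \<inter> F = {}"
  shows "strongly_orientable ends V (E \<union> F) (\<lambda>v. 0)"
proof -
  from assms(1) obtain e h k f g where pqrs: "distinct [p, q, r, s]" "V = {p, q, r, s}"
    and E: "E = {e, h, k, f, g}"
    and ends: "ends e = {p, q}" "ends h = {p, r}" "ends k = {q, r}" "ends f = {p, s}" "ends g = {q, s}"
    unfolding diamond_def by blast
  from assms(2) obtain e' h' k' f' g' where F: "F = {e', h', k', f', g'}"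
    and ends': "ends e' = {r, s}" "ends h' = {r, p}" "ends k' = {s, p}" "ends f' = {r, q}" "ends g' = {s, q}"
    unfolding diamond_def by blast
  have dist: "distinct [e, h, k, f, g]" using pqrs(1) ends by (auto simp: doubleton_eq_iff)
  have dist': "distinct [e', h', k', f', g']" using pqrs(1) ends' by (auto simp: doubleton_eq_iff)
  let ?xs = "[(e, p, q), (h, p, r), (k, q, r), (f, p, s), (g, q, s)]"
  let ?ys = "[(e', s, r), (h', r, p), (k', p, s), (f', q, r), (g', q, s)]"
  let ?A = "snd ` set ?xs \<union> snd ` set ?ys"
  let ?\<beta> = "\<lambda>v. (\<Sum>(e, y, z)\<leftarrow>?xs. edge_vec y z v) + (\<Sum>(e, y, z)\<leftarrow>?ys. edge_vec y z v)"
  have "oriented_net ends (fst ` set ?xs \<union> fst ` set ?ys) ?A ?\<beta>"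
  proof (intro oriented_net_union oriented_net_list)
    show "fst ` set ?xs \<inter> fst ` set ?ys = {}" using assms(3) E F by auto
  qed (use dist dist' ends ends' pqrs(1) in \<open>auto simp: insert_commute\<close>)
  moreover have "fst ` set ?xs \<union> fst ` set ?ys = E \<union> F" by (simp add: E F)
  ultimately have "oriented_net ends (E \<union> F) ?A ?\<beta>" by simp
  then show ?thesis
  proof (rule strongly_orientableI[where p = p])
    show "0 = ?\<beta> v" for v
      using pqrs(1) by (auto simp: edge_vec_def of_bool_def)
  next
    have a: "(p, q) \<in> ?A\<^sup>*" "(p, r) \<in> ?A\<^sup>*" "(p, s) \<in> ?A\<^sup>*" "(q, r) \<in> ?A\<^sup>*" "(r, p) \<in> ?A\<^sup>*" "(s, r) \<in> ?A\<^sup>*"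
      by (intro r_into_rtrancl; simp)+
    then have "(q, p) \<in> ?A\<^sup>*" "(s, p) \<in> ?A\<^sup>*" by (meson rtrancl_trans)+
    with a show "(p, v) \<in> ?A\<^sup>* \<and> (v, p) \<in> ?A\<^sup>*" if "v \<in> V" for v
      using that pqrs(2) by blast
  qed
qed

text \<open>Two triangles on four vertices each omit one vertex. With both coefficients nonzero, the
  combination is nonzero at both omitted vertices, which must therefore be \<open>p\<close> and
  \<open>q\<close>.\<close>

lemma full_comb_edge_vec_card_4:
  assumes pqrs: "distinct [p, q, r, s]" and "card \<T> = 2"
    and tri: "\<forall>t\<in>\<T>. card t = 3 \<and> t \<subseteq> {p, q, r, s}"
    and fc: "full_comb \<T> (\<lambda>v. - edge_vec p q v)"
  shows "\<T> = {{p, r, s}, {q, r, s}}"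
proof -
  let ?V = "{p, q, r, s}"
  obtain t t' where t: "\<T> = {t, t'}" "t \<noteq> t'" using assms(2) by (auto simp: card_2_iff)
  have missing: "\<exists>a\<in>?V. u = ?V - {a}" if "u \<in> \<T>" for u
  proof -
    have "card (?V - u) = 1"
      using tri that pqrs finite_subset[of u ?V] by (simp add: card_Diff_subset)
    then obtain a where "?V - u = {a}" by (auto simp: card_1_singleton_iff)
    moreover have "u = ?V - (?V - u)" using tri that by blast
    ultimately show ?thesis by (metis Diff_iff singletonI)
  qed
  obtain a b where ab: "a \<in> ?V" "b \<in> ?V" "t = ?V - {a}" "t' = ?V - {b}"
    using missing[of t] missing[of t'] t(1) by blast
  from fc obtain \<epsilon> where nz: "\<forall>t\<in>\<T>. \<epsilon> t \<noteq> 0" and comb: "\<And>v. - edge_vec p q v = triangle_comb \<T> \<epsilon> v"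
    unfolding full_comb_def by (elim exE conjE) (rule that, simp_all)
  have "\<epsilon> t \<noteq> 0" "\<epsilon> t' \<noteq> 0" using nz t(1) by auto
  have eq: "- edge_vec p q v = \<epsilon> t * of_bool (v \<in> t) + \<epsilon> t' * of_bool (v \<in> t')" for v
    unfolding comb t(1) using t(2) by (simp add: triangle_comb_def del: sum_mult_of_bool_eq)
  have "a \<noteq> b" using ab t(2) by auto
  \<comment> \<open>At \<open>a\<close> only \<open>t'\<close> contributes, and at \<open>b\<close>
    only \<open>t\<close>.\<close>
  have "edge_vec p q a \<noteq> 0" "edge_vec p q b \<noteq> 0"
    using eq[of a] eq[of b] ab \<open>a \<noteq> b\<close> \<open>\<epsilon> t \<noteq> 0\<close> \<open>\<epsilon> t' \<noteq> 0\<close> by auto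
  then have "a \<in> {p, q}" "b \<in> {p, q}" by (auto simp: edge_vec_def split: if_splits)
  then have "t = ?V - {p} \<and> t' = ?V - {q} \<or> t = ?V - {q} \<and> t' = ?V - {p}"
    using ab \<open>a \<noteq> b\<close> by auto
  moreover have "?V - {p} = {q, r, s}" "?V - {q} = {p, r, s}" using pqrs by auto
  ultimately show ?thesis using t(1) by auto
qed

section \<open>Combining two edge-disjoint trees\<close>

text \<open>\<open>E\<close> provides strong connectedness with some vector \<open>\<gamma>\<close>,
  and \<open>F\<close> has to realize \<open>\<beta> - \<gamma>\<close>. If this fails for all
  signed sums, counting coordinates leaves only four vertices with \<open>\<beta>\<close>
  zero.\<close>

lemma two_tree_pair_strongly_orientable:
  assumes T1: "two_tree ends V E" and T2: "two_tree ends V F" and "card F + 3 = 2 * card V"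
    and "E \<inter> F = {}" "4 \<le> card V" and \<beta>: "boundary_on V \<beta>"
  shows "strongly_orientable ends V (E \<union> F) \<beta>"
proof -
  note wf1 = two_tree_wf[OF T1] and wf2 = two_tree_wf[OF T2]
  from two_tree_triangles[OF T2] obtain \<T> where \<T>: "finite \<T>" "card \<T> + 2 = card V" "triangles_indep \<T>"
    and tri: "\<forall>t\<in>\<T>. card t = 3 \<and> t \<subseteq> V \<and>
      (\<forall>p\<in>t. \<forall>q\<in>t. p \<noteq> q \<longrightarrow> (\<exists>e\<in>F. ends e = {p, q}))"
    and dich: "\<forall>\<beta>. boundary_on V \<beta> \<longrightarrow> orientable ends F \<beta> \<or> full_comb \<T> \<beta>"
    by (elim exE conjE) (rule that)
  have tri3: "\<forall>t\<in>\<T>. card t = 3" using tri by blast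
  have split: "strongly_orientable ends V (E \<union> F) \<beta> \<or> full_comb \<T> (\<lambda>v. \<beta> v - \<gamma> v)"
    if "strongly_orientable ends V E \<gamma>" for \<gamma>
  proof -
    from that obtain A where "oriented_net ends E A \<gamma>" unfolding strongly_orientable_def by blast
    then have "boundary_on V \<gamma>" using oriented_net_boundary_on wf1 by blast
    from dich[rule_format, OF boundary_on_diff[OF \<beta> this]] show ?thesis
    proof
      assume "orientable ends F (\<lambda>v. \<beta> v - \<gamma> v)"
      from strongly_orientable_union[OF that this assms(4)] show ?thesis by simp
    qed simp
  qed
  show ?thesis
  proof (rule ccontr)
    assume not: "\<not> ?thesis"
    show False
    proof (cases "card V = 4")
      case False
      from two_tree_strongly_orientable[OF T1 assms(5)] obtain us
        where us: "length us + 3 = card V" "\<forall>(y, z)\<in>set us. y \<noteq> z"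
          "\<forall>\<gamma>\<in>signed_sums us. strongly_orientable ends V E \<gamma>" by blast
      \<comment> \<open>With n vertices this reads 2(n - 3) \<le> n - 2, which is false from n = 5
        on.\<close>
      have "2 * length us \<le> card \<T>"
        using signed_sums_full_comb[OF \<T>(3,1) tri3 subset_refl us(2)] us(3) split not by blast
      then show False using us(1) \<T>(2) False assms(5) by simp
    next
      case True
      from two_tree_card_4[OF T1 True] obtain p q r s where d: "diamond ends V E p q r s" by blast
      then have pqrs: "distinct [p, q, r, s]" and V: "V = {p, q, r, s}" by (simp_all add: diamond_def)
      have fc: "full_comb \<T> (\<lambda>v. \<beta> v - \<gamma> v)" if "\<gamma> \<in> signed_sums [(p, q)]" for \<gamma>
        using split[OF diamond_strongly_orientable[OF d that]] not by blast
      have "2 * length [(p, q)] = card \<T> \<longrightarrow> \<beta> = (\<lambda>v. 0)"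
        by (rule signed_sums_full_comb[OF \<T>(3,1) tri3 subset_refl _ fc, THEN conjunct2]) (use pqrs in simp)
      then have \<beta>0: "\<beta> = (\<lambda>v. 0)" using \<T>(2) True by simp
      \<comment> \<open>Failure for this one sum fixes the triangles of \<open>F\<close>: they share
        \<open>rs\<close>, whereas those of \<open>E\<close> share \<open>pq\<close>.\<close>
      have "full_comb \<T> (\<lambda>v. - edge_vec p q v)" using fc[of "edge_vec p q"] \<beta>0 by simp
      then have "\<T> = {{p, r, s}, {q, r, s}}"
        using full_comb_edge_vec_card_4[OF pqrs] tri V \<T>(2) True by simp
      then have adj: "\<exists>e\<in>F. ends e = {a, b}"
        if "{a, b} \<subseteq> {p, r, s} \<or> {a, b} \<subseteq> {q, r, s}" "a \<noteq> b" for a b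
        using tri that by auto
      obtain e h k f g where eF: "{e, h, k, f, g} \<subseteq> F"
        and ends: "ends e = {r, s}" "ends h = {r, p}" "ends k = {s, p}" "ends f = {r, q}" "ends g = {s, q}"
        using adj[of r s] adj[of r p] adj[of s p] adj[of r q] adj[of s q] pqrs by auto
      \<comment> \<open>A two-tree on four vertices has five edges, so the edges found exhaust
        \<open>F\<close> and make it the opposite diamond.\<close>
      have "distinct [e, h, k, f, g]" using pqrs ends by (auto simp: doubleton_eq_iff)
      then have "card {e, h, k, f, g} = 5" by simp
      moreover have "card F = 5" using assms(3) True by simp
      moreover from this have "finite F" by (simp add: card_ge_0_finite)
      ultimately have "F = {e, h, k, f, g}" using card_subset_eq eF by metis
      moreover have "distinct [r, s, p, q]" "V = {r, s, p, q}" using pqrs V by auto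
      ultimately have "diamond ends V F r s p q"
        unfolding diamond_def using ends by blast
      then show False
        using opposite_diamonds_strongly_orientable[OF d _ assms(4)] not \<beta>0 by simp
    qed
  qed
qed

section \<open>Transfer to digraphs and conclusion\<close>

lemma strongly_orientable_digraph:
  fixes G :: "('a, 'e) multigraph"
  assumes "strongly_orientable (mends G) (mverts G) (medges G) \<gamma>" "mverts G \<noteq> {}"
    and sub: "\<forall>e\<in>medges G. mends G e \<subseteq> mverts G"
    and eq: "\<And>u. u \<in> mverts G \<Longrightarrow> \<gamma> u = of_int (\<beta> u)"
  shows "\<exists>D. orientation D G \<and> strongly_connected D \<and>
    (\<forall>u\<in>mverts G. [int (out_degree D u) - int (in_degree D u) = \<beta> u] (mod 3))"
proof -
  from assms(1) obtain A where on: "oriented_net (mends G) (medges G) A \<gamma>"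
    and reach: "mverts G \<times> mverts G \<subseteq> A\<^sup>*"
    unfolding strongly_orientable_def by blast
  from oriented_net_orientation[OF on] obtain t h
    where th: "\<forall>e\<in>medges G. {t e, h e} = mends G e" and A: "A = (\<lambda>e. (t e, h e)) ` medges G"
      and net: "\<And>v. \<gamma> v = of_int (int (card {e \<in> medges G. t e = v}) - int (card {e \<in> medges G. h e = v}))"
    by blast
  define D where "D = \<lparr>verts = mverts G, arcs = medges G, tail = t, head = h\<rparr>"
  have "orientation D G" using th by (simp add: orientation_def D_def)
  moreover have "strongly_connected D"
  proof -
    interpret wf_digraph D
      by unfold_locales (use th sub in \<open>auto simp: D_def\<close>)
    have "arcs_ends D = A" by (auto simp: arcs_ends_def arc_to_ends_def D_def A)
    moreover have "verts D = mverts G" by (simp add: D_def)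
    ultimately show ?thesis
      unfolding strongly_connected_def reachable_conv using assms(2) reach by auto
  qed
  moreover have "[int (out_degree D u) - int (in_degree D u) = \<beta> u] (mod 3)"
    if "u \<in> mverts G" for u
    using eq[OF that] net[of u] unfolding z3_of_int_eq_iff[symmetric]
    by (simp add: out_degree_def in_degree_def out_arcs_def in_arcs_def D_def)
  ultimately show ?thesis by blast
qed

text \<open>A subgraph carries its own end map, which agrees with that of \<open>G\<close> only on
  the edges of the subgraph.\<close>

lemma triangle_tree_on_cong:
  assumes "triangle_tree_on ends V E" "\<forall>e\<in>E. ends e = ends' e"
  shows "triangle_tree_on ends' V E"
  using assms
proof induction
  case (triangle x1 x2 x3 e1 e2 e3)
  then show ?case by (intro triangle_tree_on.triangle) auto
next
  case (add_vertex V E x e y z f g)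
  then show ?case by (intro triangle_tree_on.add_vertex[where e = e and y = y and z = z]) auto
qed

theorem theorem4p3:
  fixes G :: "('a, 'e) multigraph"
  assumes "fin_loopless_multigraph G"
    and "card (mverts G) \<ge> 4"
    and "\<exists>T\<^sub>1 T\<^sub>2. spanning_triangle_tree T\<^sub>1 G \<and> spanning_triangle_tree T\<^sub>2 G \<and>
           medges T\<^sub>1 \<inter> medges T\<^sub>2 = {}"
  shows "G \<in> S3"
proof -
  interpret fin_loopless_multigraph G by fact
  let ?ends = "mends G" and ?V = "mverts G"
  have spanning: "triangle_tree_on ?ends ?V (medges T) \<and> medges T \<subseteq> medges G"
    if "spanning_triangle_tree T G" for T
    using that triangle_tree_on_cong
    unfolding spanning_triangle_tree_def triangle_tree_def msubgraph_def by metis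
  from assms(3) obtain E F where E: "triangle_tree_on ?ends ?V E" "E \<subseteq> medges G"
    and F: "triangle_tree_on ?ends ?V F" "F \<subseteq> medges G" and disj: "E \<inter> F = {}"
    using spanning by blast
  have "\<exists>D. orientation D G \<and> strongly_connected D \<and>
      (\<forall>u\<in>?V. [int (out_degree D u) - int (in_degree D u) = \<beta> u] (mod 3))"
    if \<beta>: "Z3_boundary G \<beta>" for \<beta>
  proof -
    \<comment> \<open>Edges outside both trees are oriented arbitrarily and their contribution
      \<open>\<delta>\<close> is subtracted from the boundary; adding them back preserves strong
      connectedness.\<close>
    let ?X = "medges G - (E \<union> F)"
    obtain A \<delta> where \<delta>: "oriented_net ?ends ?X A \<delta>"
      using oriented_net_exists[of ?X ?ends] finite_medges card_mends by auto
    have "boundary_on ?V \<delta>"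
      using oriented_net_boundary_on[OF \<delta> finite_mverts] mends_subset by auto
    \<comment> \<open>The given \<open>\<beta>\<close> is arbitrary outside the vertex set, whereas
      \<open>boundary_on\<close> requires 0 there.\<close>
    moreover let ?\<beta> = "\<lambda>v. if v \<in> ?V then of_int (\<beta> v) else 0 :: 3"
    have "boundary_on ?V ?\<beta>"
    proof -
      have "sum ?\<beta> ?V = of_int (sum \<beta> ?V)" by simp
      also have "\<dots> = of_int 0" unfolding z3_of_int_eq_iff using \<beta> by (simp add: Z3_boundary_def)
      finally show ?thesis by (simp add: boundary_on_def)
    qed
    ultimately have "boundary_on ?V (\<lambda>v. ?\<beta> v - \<delta> v)" using boundary_on_diff by blast
    then have "strongly_orientable ?ends ?V (E \<union> F) (\<lambda>v. ?\<beta> v - \<delta> v)"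
      using two_tree_pair_strongly_orientable[OF E(1)[THEN triangle_tree_on_imp_two_tree]
          F(1)[THEN triangle_tree_on_imp_two_tree] _ disj assms(2)] triangle_tree_on_wf[OF F(1)]
      by blast
    then have "strongly_orientable ?ends ?V (E \<union> F \<union> ?X) (\<lambda>v. ?\<beta> v - \<delta> v + \<delta> v)"
      by (rule strongly_orientable_union) (use \<delta> in \<open>auto simp: orientable_def\<close>)
    moreover have "E \<union> F \<union> ?X = medges G" using E F by blast
    ultimately have "strongly_orientable ?ends ?V (medges G) ?\<beta>" by simp
    then show ?thesis
      by (rule strongly_orientable_digraph) (use assms(2) mends_subset in auto)
  qed
  then show ?thesis using assms(1) by (simp add: S3_def)
qed

end
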